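(* Let $\Gamma$ be a graph of type $A_n$, $n\ge 1$. Then the number of multiplicity free elements in the Hecke-Kiselman monoid $HK_\Gamma$ is the Fibonacci number $F_{2n+1}$ (where $F_1=F_2=1$). In particular, it does not depend on the orientation of the edges in $\Gamma$.
   Context: A graph of type $A_n$ is a directed graph with vertices $v_1,\dots,v_n$ such that for each $i\in\{1,\dots,n-1\}$ there is exactly one directed edge between $v_i$ and $v_{i+1}$ (in either direction), and there are no other edges. For a finite directed graph $\Gamma$ without loops and with at most one directed edge between any pair of vertices, the Hecke-Kiselman monoid $HK_\Gamma$ is the quotient of the free monoid $V(\Gamma)^*$ on the vertex set by the relations: $x^2=x$ for all $x\in V(\Gamma)$; $xy=yx$ if there is no edge between $x$ and $y$; $xyx=yxy=xy$ if there is an edge $x\to y$. The class of a word $\mathbf{w}$ is $[\mathbf{w}]$. A word in $V(\Gamma)^*$ is multiplicity free if every vertex occurs in it at most once. An element of $HK_\Gamma$ is multiplicity free if it contains (as an equivalence class of words) a multiplicity free word. *)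

theory Defs
  imports
    "Graph_Theory.Pair_Digraph"
    "HOL-Algebra.Group"
    "HOL-Number_Theory.Fib"
begin

text \<open>
  A directed graph is a \<^typ>\<open>'a pair_pre_digraph\<close>, whose arcs are ordered pairs of vertices:
  there are no parallel arcs in one direction, and the last assumption below excludes a pair of
  opposite arcs.
\<close>

locale hk_digraph = pair_digraph +
  assumes at_most_one_arc: "(x, y) \<in> parcs G \<Longrightarrow> (y, x) \<notin> parcs G"

definition type_A :: "nat \<Rightarrow> 'a pair_pre_digraph \<Rightarrow> bool" where
  "type_A n G \<longleftrightarrow>
    (\<exists>v. bij_betw v {1..n} (pverts G) \<and>
         (\<forall>i\<in>{1..<n}. ((v i, v (i + 1)) \<in> parcs G) \<noteq> ((v (i + 1), v i) \<in> parcs G)) \<and>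
         parcs G \<subseteq> (\<Union>i\<in>{1..<n}. {(v i, v (i + 1)), (v (i + 1), v i)}))"

inductive_set hk_relations :: "'a pair_pre_digraph \<Rightarrow> ('a list \<times> 'a list) set"
  for G :: "'a pair_pre_digraph" where
  idem: "x \<in> pverts G \<Longrightarrow> ([x, x], [x]) \<in> hk_relations G"
| comm: "x \<in> pverts G \<Longrightarrow> y \<in> pverts G \<Longrightarrow> (x, y) \<notin> parcs G \<Longrightarrow> (y, x) \<notin> parcs G
    \<Longrightarrow> ([x, y], [y, x]) \<in> hk_relations G"
| arc_left: "(x, y) \<in> parcs G \<Longrightarrow> ([x, y, x], [x, y]) \<in> hk_relations G"
| arc_right: "(x, y) \<in> parcs G \<Longrightarrow> ([y, x, y], [x, y]) \<in> hk_relations G"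

text \<open>The congruence on the free monoid \<^term>\<open>lists (pverts G)\<close> generated by these relations.\<close>

inductive_set hk_cong :: "'a pair_pre_digraph \<Rightarrow> ('a list \<times> 'a list) set"
  for G :: "'a pair_pre_digraph" where
  rel: "(u, v) \<in> hk_relations G \<Longrightarrow> (u, v) \<in> hk_cong G"
| refl: "w \<in> lists (pverts G) \<Longrightarrow> (w, w) \<in> hk_cong G"
| sym: "(u, v) \<in> hk_cong G \<Longrightarrow> (v, u) \<in> hk_cong G"
| trans: "(u, v) \<in> hk_cong G \<Longrightarrow> (v, w) \<in> hk_cong G \<Longrightarrow> (u, w) \<in> hk_cong G"
| append: "(u, v) \<in> hk_cong G \<Longrightarrow> (u', v') \<in> hk_cong G \<Longrightarrow> (u @ u', v @ v') \<in> hk_cong G"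

definition hk_class :: "'a pair_pre_digraph \<Rightarrow> 'a list \<Rightarrow> 'a list set" where
  "hk_class G w = hk_cong G `` {w}"

text \<open>
  The union in the product is over representatives; it is a single class by
  \<open>hk_class_mult\<close> below.
\<close>

definition HK :: "'a pair_pre_digraph \<Rightarrow> 'a list set monoid" where
  "HK G = \<lparr>carrier = lists (pverts G) // hk_cong G,
           mult = (\<lambda>X Y. \<Union>u\<in>X. \<Union>v\<in>Y. hk_class G (u @ v)),
           one = hk_class G []\<rparr>"

definition multiplicity_free :: "'a list set \<Rightarrow> bool" where
  "multiplicity_free X \<longleftrightarrow> (\<exists>w\<in>X. distinct w)"

lemma type_A_hk_digraph:
  assumes "type_A n G"
  shows "hk_digraph G"
proof -
  obtain v where b: "bij_betw v {1..n} (pverts G)"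
    and x: "\<And>i. i \<in> {1..<n} \<Longrightarrow> ((v i, v (i + 1)) \<in> parcs G) \<noteq> ((v (i + 1), v i) \<in> parcs G)"
    and s: "parcs G \<subseteq> (\<Union>i\<in>{1..<n}. {(v i, v (i + 1)), (v (i + 1), v i)})"
    using assms unfolding type_A_def by blast
  have inV: "v i \<in> pverts G" if "i \<in> {1..n}" for i
    using b that by (auto simp: bij_betw_def)
  have inj: "v i \<noteq> v (i + 1)" if "i \<in> {1..<n}" for i
  proof
    assume "v i = v (i + 1)"
    moreover have "i \<in> {1..n}" "i + 1 \<in> {1..n}" using that by auto
    ultimately have "i = i + 1"
      using b unfolding bij_betw_def by (meson inj_onD)
    then show False by simp
  qed
  have fin: "finite (pverts G)" using b bij_betw_finite by blast
  have arcs: "\<exists>i\<in>{1..<n}. e = (v i, v (i + 1)) \<or> e = (v (i + 1), v i)" if "e \<in> parcs G" for e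
    using s that by blast
  have ends: "fst e \<in> pverts G \<and> snd e \<in> pverts G \<and> fst e \<noteq> snd e" if e: "e \<in> parcs G" for e
  proof -
    obtain i where i: "i \<in> {1..<n}" "e = (v i, v (i + 1)) \<or> e = (v (i + 1), v i)"
      using arcs[OF e] by blast
    have "v i \<in> pverts G" "v (i + 1) \<in> pverts G" using i(1) by (auto intro!: inV)
    then show ?thesis using i inj[OF i(1)] by auto
  qed
  have "parcs G \<subseteq> pverts G \<times> pverts G" using ends by (auto simp: mem_Times_iff)
  then have finA: "finite (parcs G)" using fin finite_subset by blast
  show ?thesis
  proof unfold_locales
    fix x y assume xy: "(x, y) \<in> parcs G"
    obtain i where i: "i \<in> {1..<n}" "(x, y) = (v i, v (i + 1)) \<or> (x, y) = (v (i + 1), v i)"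
      using arcs[OF xy] by blast
    then show "(y, x) \<notin> parcs G" using x[OF i(1)] xy by auto
  qed (use ends fin finA in auto)
qed

lemma (in hk_digraph) hk_cong_lists:
  assumes "(u, v) \<in> hk_cong G"
  shows "u \<in> lists (pverts G) \<and> v \<in> lists (pverts G)"
  using assms
proof induction
  case (rel u v)
  then show ?case
    by cases (auto dest: in_arcsD1 in_arcsD2)
qed auto

lemma (in hk_digraph) equiv_hk_cong: "equiv (lists (pverts G)) (hk_cong G)"
proof (rule equivI)
  show "hk_cong G \<subseteq> lists (pverts G) \<times> lists (pverts G)"
    using hk_cong_lists by auto
  show "refl_on (lists (pverts G)) (hk_cong G)"
    by (rule refl_onI) (rule hk_cong.refl)
  show "sym (hk_cong G)" by (rule symI) (rule hk_cong.sym)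
  show "trans (hk_cong G)" by (rule transI) (rule hk_cong.trans)
qed

lemma (in hk_digraph) hk_class_mult:
  assumes "u \<in> lists (pverts G)" "v \<in> lists (pverts G)"
  shows "hk_class G u \<otimes>\<^bsub>HK G\<^esub> hk_class G v = hk_class G (u @ v)"
proof -
  have "hk_class G (u' @ v') = hk_class G (u @ v)"
    if "u' \<in> hk_class G u" "v' \<in> hk_class G v" for u' v'
  proof -
    have "(u @ v, u' @ v') \<in> hk_cong G"
      using that by (intro hk_cong.append) (simp_all add: hk_class_def)
    then show ?thesis
      unfolding hk_class_def by (rule equiv_class_eq[OF equiv_hk_cong, symmetric])
  qed
  moreover have "u \<in> hk_class G u" "v \<in> hk_class G v"
    using assms by (auto simp: hk_class_def intro: hk_cong.refl)
  ultimately have "(\<Union>u'\<in>hk_class G u. \<Union>v'\<in>hk_class G v. hk_class G (u' @ v')) = hk_class G (u @ v)"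
    by blast
  then show ?thesis by (simp add: HK_def)
qed

lemma (in hk_digraph) monoid_HK: "Group.monoid (HK G)"
proof -
  have car: "X \<in> carrier (HK G) \<longleftrightarrow> (\<exists>w\<in>lists (pverts G). X = hk_class G w)" for X
    by (auto simp: HK_def hk_class_def quotient_def)
  have one: "\<one>\<^bsub>HK G\<^esub> = hk_class G []" by (simp add: HK_def)
  have cls: "hk_class G w \<in> carrier (HK G)" if "w \<in> lists (pverts G)" for w
    using that car by blast
  show ?thesis
  proof (rule monoidI)
    show "\<one>\<^bsub>HK G\<^esub> \<in> carrier (HK G)" by (simp add: one cls)
  next
    fix X Y assume "X \<in> carrier (HK G)" "Y \<in> carrier (HK G)"
    then obtain u v where "u \<in> lists (pverts G)" "X = hk_class G u"
      "v \<in> lists (pverts G)" "Y = hk_class G v" unfolding car by blast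
    then show "X \<otimes>\<^bsub>HK G\<^esub> Y \<in> carrier (HK G)"
      using hk_class_mult[of u v] cls[of "u @ v"] by simp
  next
    fix X Y Z assume "X \<in> carrier (HK G)" "Y \<in> carrier (HK G)" "Z \<in> carrier (HK G)"
    then obtain u v w where uvw: "u \<in> lists (pverts G)" "X = hk_class G u"
      "v \<in> lists (pverts G)" "Y = hk_class G v" "w \<in> lists (pverts G)" "Z = hk_class G w"
      unfolding car by blast
    have "u @ v \<in> lists (pverts G)" "v @ w \<in> lists (pverts G)" using uvw by auto
    then show "(X \<otimes>\<^bsub>HK G\<^esub> Y) \<otimes>\<^bsub>HK G\<^esub> Z = X \<otimes>\<^bsub>HK G\<^esub> (Y \<otimes>\<^bsub>HK G\<^esub> Z)"
      using uvw hk_class_mult[of u v] hk_class_mult[of v w]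
        hk_class_mult[of "u @ v" w] hk_class_mult[of u "v @ w"] by simp
  next
    fix X assume "X \<in> carrier (HK G)"
    then obtain u where "u \<in> lists (pverts G)" "X = hk_class G u" unfolding car by blast
    then show "\<one>\<^bsub>HK G\<^esub> \<otimes>\<^bsub>HK G\<^esub> X = X" and "X \<otimes>\<^bsub>HK G\<^esub> \<one>\<^bsub>HK G\<^esub> = X"
      using hk_class_mult[of "[]" u] hk_class_mult[of u "[]"] by (simp_all add: one)
  qed
qed

end

theory Submission
  imports Defs
begin

text \<open>
  Two data are constant on a class of words: the set of letters, and, for each arc \<open>(x, y)\<close>, whether
  some \<open>x\<close> occurs before some \<open>y\<close>. In a multiplicity free word over \<open>v\<^sub>1, \<dots>, v\<^sub>k\<^sub>+\<^sub>1\<close> the last vertex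
  commutes with everything except \<open>v\<^sub>k\<close>, so it can be moved to one of the two ends of the word: to
  the front if it stands before \<open>v\<^sub>k\<close>, and to the back otherwise. By recursion this gives normal
  forms, and the invariants show that they represent pairwise distinct elements. Counting the
  normal forms together with those that contain the last vertex gives the recursion of
  \<open>(F\<^sub>2\<^sub>k\<^sub>+\<^sub>1, F\<^sub>2\<^sub>k)\<close>.
\<close>

section \<open>Invariants of the congruence\<close>

primrec occurs_before :: "'a \<Rightarrow> 'a \<Rightarrow> 'a list \<Rightarrow> bool" where
  "occurs_before x y [] \<longleftrightarrow> False"
| "occurs_before x y (z # w) \<longleftrightarrow> z = x \<and> y \<in> set w \<or> occurs_before x y w"

lemma occurs_before_append:
  "occurs_before x y (u @ w) \<longleftrightarrow>
    occurs_before x y u \<or> occurs_before x y w \<or> x \<in> set u \<and> y \<in> set w"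
  by (induction u) auto

lemma occurs_before_in_set: "occurs_before x y w \<Longrightarrow> x \<in> set w \<and> y \<in> set w"
  by (induction w) auto

context hk_digraph
begin

lemma hk_cong_set_eq: "(u, w) \<in> hk_cong G \<Longrightarrow> set u = set w"
proof (induction rule: hk_cong.induct)
  case (rel u w)
  then show ?case by cases auto
qed auto

text \<open>Only a relation between \<open>x\<close> and \<open>y\<close> themselves could matter,
  and these come from the arc \<open>(x, y)\<close>: the words \<open>xyx\<close>,
  \<open>yxy\<close> and \<open>xy\<close> all have an \<open>x\<close> before a \<open>y\<close>.
  The reverse arc and commutation of \<open>x\<close> with \<open>y\<close> are excluded. In a
  concatenation the pair may straddle the two factors, hence the appeal to
  \<open>hk_cong_set_eq\<close>.\<close>

lemma hk_cong_occurs_before_iff: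
  assumes "(u, w) \<in> hk_cong G" and arc: "(x, y) \<in> parcs G"
  shows "occurs_before x y u \<longleftrightarrow> occurs_before x y w"
  using assms(1)
proof (induction rule: hk_cong.induct)
  case (rel u w)
  have "x \<noteq> y" "(y, x) \<notin> parcs G"
    using arc at_most_one_arc by blast+
  with rel arc show ?case by cases auto
next
  case (append u w u' w')
  then show ?case
    by (simp add: occurs_before_append hk_cong_set_eq)
qed auto

lemma hk_cong_move:
  assumes "x \<in> pverts G" "w \<in> lists (pverts G)"
    and "\<And>z. z \<in> set w \<Longrightarrow> (x, z) \<notin> parcs G \<and> (z, x) \<notin> parcs G"
  shows "(x # w, w @ [x]) \<in> hk_cong G"
  using assms(2,3)
proof induction
  case Nil
  then show ?case using assms(1) by (auto intro: hk_cong.refl)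
next
  case (Cons z w)
  have "z \<in> pverts G" "(x, z) \<notin> parcs G" "(z, x) \<notin> parcs G"
    using Cons.hyps Cons.prems by simp_all
  then have "([x, z], [z, x]) \<in> hk_cong G"
    using assms(1) by (blast intro: hk_cong.rel hk_relations.comm)
  moreover have "(w, w) \<in> hk_cong G" "([z], [z]) \<in> hk_cong G"
    using Cons.hyps Cons.prems by (auto intro: hk_cong.refl)
  moreover have "(x # w, w @ [x]) \<in> hk_cong G"
    using Cons by auto
  ultimately have "([x, z] @ w, [z, x] @ w) \<in> hk_cong G" "([z] @ x # w, [z] @ w @ [x]) \<in> hk_cong G"
    by (blast intro: hk_cong.append)+
  then show ?case by (auto intro: hk_cong.trans)
qed

end

section \<open>Enumerated paths and their normal forms\<close>

text \<open>Fixes an enumeration as provided by \<open>type_A\<close>. A plain disjunction is enough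
  in \<open>consecutive\<close>, because \<open>at_most_one_arc\<close> already makes the two cases
  exclusive.\<close>

locale hk_path = hk_digraph G for G :: "'a pair_pre_digraph" +
  fixes v :: "nat \<Rightarrow> 'a" and n :: nat
  assumes bij_v: "bij_betw v {1..n} (pverts G)"
    and consecutive: "i \<in> {1..<n} \<Longrightarrow> (v i, v (i + 1)) \<in> parcs G \<or> (v (i + 1), v i) \<in> parcs G"
    and parcs_sub: "parcs G \<subseteq> (\<Union>i\<in>{1..<n}. {(v i, v (i + 1)), (v (i + 1), v i)})"
begin

lemma v_eq_iff: "\<lbrakk>i \<in> {1..n}; j \<in> {1..n}\<rbrakk> \<Longrightarrow> v i = v j \<longleftrightarrow> i = j"
  using bij_v by (auto simp: bij_betw_def dest: inj_onD)

lemma v_in_pverts: "i \<in> {1..n} \<Longrightarrow> v i \<in> pverts G"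
  using bij_v by (auto simp: bij_betw_def)

lemma v_Suc_notin: "k < n \<Longrightarrow> v (Suc k) \<notin> v ` {1..k}"
  by (auto simp: v_eq_iff)

lemma v_sub_pverts: "k \<le> n \<Longrightarrow> v ` {1..k} \<subseteq> pverts G"
  by (auto intro!: v_in_pverts)

lemma no_arc:
  assumes "k < n" "z \<in> v ` {1..k}" "z \<noteq> v k"
  shows "(v (Suc k), z) \<notin> parcs G \<and> (z, v (Suc k)) \<notin> parcs G"
proof -
  obtain j where j: "j \<in> {1..k}" "z = v j" "j \<noteq> k"
    using assms(2,3) by blast
  have "(v (Suc k), v j) \<noteq> e \<and> (v j, v (Suc k)) \<noteq> e"
    if "i \<in> {1..<n}" "e = (v i, v (i + 1)) \<or> e = (v (i + 1), v i)" for i e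
    using that j assms(1) by (auto simp: v_eq_iff)
  then show ?thesis using parcs_sub j(2) by blast
qed

text \<open>
  The value \<open>v 0\<close> is arbitrary and may be a vertex; it does no harm in the step from \<open>0\<close> to \<open>1\<close>
  because the only normal form at \<open>0\<close> is the empty word.
\<close>

primrec normal_forms :: "nat \<Rightarrow> 'a list set" where
  "normal_forms 0 = {[]}"
| "normal_forms (Suc k) = normal_forms k \<union> (\<lambda>w. w @ [v (Suc k)]) ` normal_forms k
     \<union> (\<lambda>w. v (Suc k) # w) ` {w \<in> normal_forms k. v k \<in> set w}"

lemma normal_forms_set: "w \<in> normal_forms k \<Longrightarrow> set w \<subseteq> v ` {1..k}"
  by (induction k arbitrary: w) fastforce+

lemma v_Suc_notin_normal_form: "\<lbrakk>k < n; w \<in> normal_forms k\<rbrakk> \<Longrightarrow> v (Suc k) \<notin> set w"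
  using normal_forms_set v_Suc_notin by blast

lemma normal_forms_distinct: "\<lbrakk>k \<le> n; w \<in> normal_forms k\<rbrakk> \<Longrightarrow> distinct w"
proof (induction k arbitrary: w)
  case (Suc k)
  then have "v (Suc k) \<notin> set u" "distinct u" if "u \<in> normal_forms k" for u
    using that v_Suc_notin_normal_form by auto
  with Suc.prems show ?case by auto
qed simp

section \<open>Counting the normal forms\<close>

lemma finite_normal_forms: "finite (normal_forms k)"
  by (induction k) auto

text \<open>If N and B are the two cardinalities at \<open>k\<close>, those at \<open>Suc k\<close>
  are 2N + B and N + B, so neither count can be proved by induction alone. At \<open>0\<close> the
  second set is empty whatever \<open>v 0\<close> is, matching \<open>fib 0 = 0\<close>.\<close>

lemma card_normal_forms:
  "k \<le> n \<Longrightarrow> card (normal_forms k) = fib (2 * k + 1) \<and>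
     card {w \<in> normal_forms k. v k \<in> set w} = fib (2 * k)"
proof (induction k)
  case (Suc k)
  let ?N = "normal_forms k" and ?B = "{w \<in> normal_forms k. v k \<in> set w}" and ?x = "v (Suc k)"
  have notin: "?x \<notin> set w" if "w \<in> ?N" for w
    using that Suc.prems(1) by (intro v_Suc_notin_normal_form) auto
  have card_back: "card ((\<lambda>w. w @ [?x]) ` ?N) = card ?N"
    by (rule card_image) (auto simp: inj_on_def)
  have card_front: "card ((\<lambda>w. ?x # w) ` ?B) = card ?B"
    by (rule card_image) (auto simp: inj_on_def)
  \<comment> \<open>A common word starts with \<open>?x\<close>, which then is also its final
    letter, so it is \<open>[?x]\<close>; but the words built from \<open>?B\<close> also contain a
    letter \<open>v k\<close> after the initial \<open>?x\<close>.\<close>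
  have disj: "(\<lambda>w. w @ [?x]) ` ?N \<inter> (\<lambda>w. ?x # w) ` ?B = {}"
    using notin by (fastforce simp: append_eq_Cons_conv)
  have ends: "card ((\<lambda>w. w @ [?x]) ` ?N \<union> (\<lambda>w. ?x # w) ` ?B) = card ?N + card ?B"
    using disj by (subst card_Un_disjoint) (auto simp: card_back card_front finite_normal_forms)
  have "{w \<in> normal_forms (Suc k). ?x \<in> set w} = (\<lambda>w. w @ [?x]) ` ?N \<union> (\<lambda>w. ?x # w) ` ?B"
    using notin by auto
  moreover have "card (normal_forms (Suc k))
      = card ?N + card ((\<lambda>w. w @ [?x]) ` ?N \<union> (\<lambda>w. ?x # w) ` ?B)"
    unfolding normal_forms.simps Un_assoc
    by (subst card_Un_disjoint) (auto simp: finite_normal_forms dest: notin)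
  ultimately show ?case
    using Suc ends by (simp add: eval_nat_numeral)
qed simp

section \<open>Reduction of multiplicity free words to normal form\<close>

lemma ex_normal_form:
  "\<lbrakk>k \<le> n; distinct w; set w \<subseteq> v ` {1..k}\<rbrakk> \<Longrightarrow> \<exists>u\<in>normal_forms k. (w, u) \<in> hk_cong G"
proof (induction k arbitrary: w)
  case 0
  then show ?case by (auto intro: hk_cong.refl)
next
  case (Suc k)
  let ?x = "v (Suc k)"
  have x: "?x \<in> pverts G" "([?x], [?x]) \<in> hk_cong G"
    using Suc.prems by (auto intro!: v_in_pverts hk_cong.refl)
  show ?case
  proof (cases "?x \<in> set w")
    case False
    then have "set w \<subseteq> v ` {1..k}"
      using Suc.prems(3) by (auto simp: atLeastAtMostSuc_conv)
    then show ?thesis using Suc.IH[of w] Suc.prems by auto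
  next
    case True
    then obtain a b where w: "w = a @ ?x # b"
      by (auto dest: split_list)
    have ab: "distinct (a @ b)" "set (a @ b) \<subseteq> v ` {1..k}"
      using Suc.prems by (auto simp: w atLeastAtMostSuc_conv)
    then obtain u where u: "u \<in> normal_forms k" "(a @ b, u) \<in> hk_cong G"
      using Suc.IH[of "a @ b"] Suc.prems(1) by auto
    have lists: "a \<in> lists (pverts G)" "b \<in> lists (pverts G)"
      using ab v_sub_pverts[of k] Suc.prems(1) by auto
    then have refl: "(a, a) \<in> hk_cong G" "(b, b) \<in> hk_cong G"
      by (auto intro: hk_cong.refl)
    show ?thesis
    \<comment> \<open>Since \<open>v k\<close> occurs at most once, at least one of \<open>a\<close>
      and \<open>b\<close> avoids it, and \<open>?x\<close> commutes past that factor. The remaining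
      \<open>a @ b\<close> is then replaced by its normal form \<open>u\<close>.\<close>
    proof (cases "v k \<in> set b")
      case True
      then have "v k \<notin> set a" using ab(1) by auto
      then have "(?x # a, a @ [?x]) \<in> hk_cong G"
        using ab Suc.prems(1) lists x by (intro hk_cong_move no_arc) auto
      then have "((a @ [?x]) @ b, (?x # a) @ b) \<in> hk_cong G"
        using refl by (intro hk_cong.append hk_cong.sym[of "?x # a"])
      moreover have "([?x] @ a @ b, [?x] @ u) \<in> hk_cong G"
        using x u by (intro hk_cong.append)
      ultimately have "(w, ?x # u) \<in> hk_cong G"
        by (auto simp: w intro: hk_cong.trans)
      \<comment> \<open>The side condition for placing \<open>?x\<close> in front survives the
        replacement of \<open>a @ b\<close> by \<open>u\<close>, as the set of letters is
        invariant.\<close>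
      moreover have "v k \<in> set u"
        using True hk_cong_set_eq[OF u(2)] by auto
      ultimately show ?thesis using u(1) by auto
    next
      case False
      then have "(?x # b, b @ [?x]) \<in> hk_cong G"
        using ab Suc.prems(1) lists x by (intro hk_cong_move no_arc) auto
      then have "(a @ ?x # b, a @ b @ [?x]) \<in> hk_cong G"
        using refl by (intro hk_cong.append)
      moreover have "((a @ b) @ [?x], u @ [?x]) \<in> hk_cong G"
        using x u by (intro hk_cong.append)
      ultimately have "(w, u @ [?x]) \<in> hk_cong G"
        by (auto simp: w intro: hk_cong.trans)
      then show ?thesis using u(1) by auto
    qed
  qed
qed

section \<open>Separation of normal forms by the invariants\<close>

text \<open>The witness is the arc joining \<open>v k\<close> and \<open>v (Suc k)\<close>: in
  either direction, the two placements of \<open>v (Suc k)\<close> give it opposite truth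
  values.\<close>

lemma occurs_before_ends:
  assumes "k < n" "v k \<in> set u" "u \<in> normal_forms k"
  shows "\<exists>(x, y) \<in> parcs G.
    occurs_before x y (u @ [v (Suc k)]) \<noteq> occurs_before x y (v (Suc k) # u)"
proof -
  \<comment> \<open>\<open>consecutive\<close> starts at index 1; at \<open>0\<close> the only
    normal form is empty and cannot contain \<open>v 0\<close>.\<close>
  have "k \<noteq> 0" using assms by (cases k) auto
  then have arc: "(v k, v (Suc k)) \<in> parcs G \<or> (v (Suc k), v k) \<in> parcs G"
    using consecutive[of k] assms(1) by auto
  have "v (Suc k) \<notin> set u"
    using assms by (intro v_Suc_notin_normal_form)
  then have "occurs_before (v k) (v (Suc k)) (u @ [v (Suc k)])"
    "\<not> occurs_before (v k) (v (Suc k)) (v (Suc k) # u)"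
    "\<not> occurs_before (v (Suc k)) (v k) (u @ [v (Suc k)])"
    "occurs_before (v (Suc k)) (v k) (v (Suc k) # u)"
    using assms(2) by (auto simp: occurs_before_append dest: occurs_before_in_set)
  then show ?thesis using arc by blast
qed

text \<open>Deleting the last vertex from both words preserves the agreement of the invariants, so
  by induction the remainders coincide. Then only the end at which that vertex stood could differ,
  and \<open>occurs_before_ends\<close> rules this out.\<close>

lemma normal_form_unique:
  "\<lbrakk>k \<le> n; w \<in> normal_forms k; w' \<in> normal_forms k; set w = set w';
    \<forall>(x, y)\<in>parcs G. occurs_before x y w \<longleftrightarrow> occurs_before x y w'\<rbrakk> \<Longrightarrow> w = w'"
proof (induction k arbitrary: w w')
  case (Suc k)
  let ?x = "v (Suc k)"
  have notin: "?x \<notin> set u" if "u \<in> normal_forms k" for u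
    using that Suc.prems(1) by (intro v_Suc_notin_normal_form) auto
  show ?case
  proof (cases "?x \<in> set w")
    case False
    then have "w \<in> normal_forms k" "w' \<in> normal_forms k"
      using Suc.prems by auto
    then show ?thesis using Suc by auto
  next
    case True
    have ends: "\<exists>u\<in>normal_forms k. (z = u @ [?x] \<or> z = ?x # u \<and> v k \<in> set u)"
      if "z \<in> normal_forms (Suc k)" "?x \<in> set z" for z
      using that notin by auto
    obtain u where u: "u \<in> normal_forms k" "w = u @ [?x] \<or> w = ?x # u \<and> v k \<in> set u"
      using ends[of w] Suc.prems True by blast
    obtain u' where u': "u' \<in> normal_forms k" "w' = u' @ [?x] \<or> w' = ?x # u' \<and> v k \<in> set u'"
      using ends[of w'] Suc.prems True by blast
    have "set w = insert ?x (set u)" "set w' = insert ?x (set u')"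
      using u u' by auto
    then have set_eq: "set u = set u'"
      using notin[OF u(1)] notin[OF u'(1)] Suc.prems(4) by (metis insert_ident)
    \<comment> \<open>Arcs at \<open>?x\<close> give false on both sides, as \<open>?x\<close> is in
      neither remainder; for all other arcs, attaching \<open>?x\<close> at an end changes
      nothing.\<close>
    have "occurs_before x y u \<longleftrightarrow> occurs_before x y u'" if "(x, y) \<in> parcs G" for x y
    proof (cases "x = ?x \<or> y = ?x")
      case True
      then show ?thesis
        using notin[OF u(1)] notin[OF u'(1)] by (auto dest: occurs_before_in_set)
    next
      case False
      then have "occurs_before x y w \<longleftrightarrow> occurs_before x y u"
        "occurs_before x y w' \<longleftrightarrow> occurs_before x y u'"
        using u u' by (auto simp: occurs_before_append)
      then show ?thesis using Suc.prems(5) that by auto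
    qed
    then have "u = u'"
      using Suc.IH[of u u'] Suc.prems(1) u(1) u'(1) set_eq by auto
    moreover have "\<not> (w = u @ [?x] \<and> w' = ?x # u \<and> v k \<in> set u)"
      "\<not> (w' = u @ [?x] \<and> w = ?x # u \<and> v k \<in> set u)"
      using occurs_before_ends[of k u] Suc.prems(1,5) u(1) by auto
    ultimately show ?thesis using u u' by auto
  qed
qed simp

section \<open>The number of multiplicity free elements\<close>

lemma card_multiplicity_free:
  "card {X \<in> carrier (HK G). multiplicity_free X} = fib (2 * n + 1)"
proof -
  have verts: "v ` {1..n} = pverts G"
    using bij_v by (simp add: bij_betw_def)
  have carrier: "carrier (HK G) = hk_class G ` lists (pverts G)"
    by (auto simp: HK_def hk_class_def quotient_def)
  have class_eq: "hk_class G u = hk_class G w" if "(u, w) \<in> hk_cong G" for u w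
    using equiv_class_eq[OF equiv_hk_cong that] by (simp add: hk_class_def)
  have "bij_betw (hk_class G) (normal_forms n) {X \<in> carrier (HK G). multiplicity_free X}"
  proof (rule bij_betw_imageI)
    show "inj_on (hk_class G) (normal_forms n)"
    proof (rule inj_onI)
      fix u w assume uw: "u \<in> normal_forms n" "w \<in> normal_forms n" "hk_class G u = hk_class G w"
      have "w \<in> lists (pverts G)"
        using normal_forms_set[OF uw(2)] unfolding verts by auto
      then have "(u, w) \<in> hk_cong G"
        using uw(3) by (auto simp: hk_class_def intro: hk_cong.refl)
      then show "u = w"
        using uw(1,2) hk_cong_set_eq hk_cong_occurs_before_iff
        by (intro normal_form_unique[of n]) auto
    qed
    show "hk_class G ` normal_forms n = {X \<in> carrier (HK G). multiplicity_free X}"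
    proof (intro equalityI subsetI)
      fix X assume "X \<in> hk_class G ` normal_forms n"
      then obtain w where w: "w \<in> normal_forms n" "X = hk_class G w" by blast
      then have "w \<in> lists (pverts G)" "distinct w"
        using normal_forms_set[OF w(1)] normal_forms_distinct[OF _ w(1)] unfolding verts by auto
      then show "X \<in> {X \<in> carrier (HK G). multiplicity_free X}"
        using w(2) by (auto simp: carrier multiplicity_free_def hk_class_def intro: hk_cong.refl)
    next
      fix X assume "X \<in> {X \<in> carrier (HK G). multiplicity_free X}"
      then obtain u w where uw: "X = hk_class G u" "(u, w) \<in> hk_cong G" "distinct w"
        by (auto simp: carrier multiplicity_free_def hk_class_def)
      then obtain w' where "w' \<in> normal_forms n" "(w, w') \<in> hk_cong G"
        using ex_normal_form[of n w] hk_cong_lists[OF uw(2)] unfolding verts by auto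
      then show "X \<in> hk_class G ` normal_forms n"
        using uw class_eq by blast
    qed
  qed
  then show ?thesis
    using card_normal_forms[of n] by (simp add: bij_betw_same_card[symmetric])
qed

end

theorem corollary4p9:
  fixes G :: "'a pair_pre_digraph" and n :: nat
  assumes "n \<ge> 1" and "type_A n G"
  shows "card {X \<in> carrier (HK G). multiplicity_free X} = fib (2 * n + 1) \<and>
    (\<forall>H :: 'a pair_pre_digraph. type_A n H \<longrightarrow>
      card {X \<in> carrier (HK H). multiplicity_free X} =
      card {X \<in> carrier (HK G). multiplicity_free X})"
proof -
  \<comment> \<open>The count for an arbitrary orientation \<open>H\<close> yields both the value
    for \<open>G\<close> and the independence of the orientation.\<close>
  have "card {X \<in> carrier (HK H). multiplicity_free X} = fib (2 * n + 1)"
    if H: "type_A n H" for H :: "'a pair_pre_digraph"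
  proof -
    obtain v where v: "bij_betw v {1..n} (pverts H)"
      "\<forall>i\<in>{1..<n}. ((v i, v (i + 1)) \<in> parcs H) \<noteq> ((v (i + 1), v i) \<in> parcs H)"
      "parcs H \<subseteq> (\<Union>i\<in>{1..<n}. {(v i, v (i + 1)), (v (i + 1), v i)})"
      using H unfolding type_A_def by blast
    interpret hk_digraph H using H by (rule type_A_hk_digraph)
    interpret hk_path H v n using v by unfold_locales blast+
    show ?thesis by (rule card_multiplicity_free)
  qed
  with assms(2) show ?thesis by simp
qed

end
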